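(* Let $d \ge 3$ and $n \ge 1$ be integers and let $\mathcal{A} \in \mathbb{R}^{n\times n\times\cdots\times n}$ be an antisymmetric tensor of order $d$. Then the multilinear rank $r$ of $\mathcal{A}$ satisfies: (i) $r = 0$ if $n < d$; (ii) $r \le d$ if $n = d$ or $n = d+1$; (iii) $r \le n$ if $n \ge d+2$. Moreover, equality can be attained in each of (i)--(iii): for all integers $d\ge 3$ and $n\ge 1$ there exists an antisymmetric tensor $\mathcal{A} \in \mathbb{R}^{n\times\cdots\times n}$ of order $d$ whose multilinear rank equals $0$ if $n<d$, equals $d$ if $n\in\{d,d+1\}$, and equals $n$ if $n \ge d+2$.
   Context: A tensor $\mathcal{A} \in \mathbb{R}^{n\times\cdots\times n}$ of order $d$ (a real array with entries $\mathcal{A}(i_1,\ldots,i_d)$, $1\le i_\mu\le n$) is antisymmetric if its entries change sign whenever two of the indices are interchanged. For $1\le\mu\le d$, the $\mu$th matricization $\mathbf{A}_{(\mu)}$ is the $n\times n^{d-1}$ matrix whose rows are indexed by $i_\mu$ and whose columns are indexed by the remaining indices $(i_\nu)_{\nu\ne\mu}$, with the entry $\mathcal{A}(i_1,\ldots,i_d)$ in the corresponding position. For an antisymmetric tensor, all matricizations have the same rank $r$, and this common value $r = \operatorname{rank}(\mathbf{A}_{(1)})$ is called the multilinear rank of $\mathcal{A}$. *)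

theory Defs
  imports Jordan_Normal_Form.DL_Rank
begin

text \<open>
  A real tensor of order \<open>d\<close> and format \<open>n \<times> \<dots> \<times> n\<close> is represented by a function on lists of
  indices. Indices and modes are numbered from \<open>0\<close>. Only the values on \<open>multi_indices d n\<close>
  are entries of the tensor; no definition below reads any other value.
\<close>

type_synonym tensor = "nat list \<Rightarrow> real"

definition multi_indices :: "nat \<Rightarrow> nat \<Rightarrow> nat list set" where
  "multi_indices d n = {js. length js = d \<and> set js \<subseteq> {..<n}}"

definition antisymmetric_tensor :: "nat \<Rightarrow> nat \<Rightarrow> tensor \<Rightarrow> bool" where
  "antisymmetric_tensor d n A \<longleftrightarrow>
     (\<forall>js \<in> multi_indices d n. \<forall>\<mu> < d. \<forall>\<nu> < d. \<mu> \<noteq> \<nu> \<longrightarrow>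
        A (js[\<mu> := js ! \<nu>, \<nu> := js ! \<mu>]) = - A js)"

definition insert_at :: "nat \<Rightarrow> nat \<Rightarrow> nat list \<Rightarrow> nat list" where
  "insert_at \<mu> i js = take \<mu> js @ i # drop \<mu> js"

text \<open>
  Column \<open>k\<close> of a matricization belongs to the \<open>k\<close>-th entry of
  \<open>List.n_lists (d - 1) [0..<n]\<close>, which lists every element of \<open>multi_indices (d - 1) n\<close>
  exactly once.
\<close>

definition matricization :: "nat \<Rightarrow> nat \<Rightarrow> nat \<Rightarrow> tensor \<Rightarrow> real mat" where
  "matricization d n \<mu> A =
     mat n (n ^ (d - 1)) (\<lambda>(i, k). A (insert_at \<mu> i (List.n_lists (d - 1) [0..<n] ! k)))"

text \<open>
  For an antisymmetric tensor every mode gives the same rank, see \<open>rank_matricization\<close> below.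
\<close>

definition multilinear_rank :: "nat \<Rightarrow> nat \<Rightarrow> tensor \<Rightarrow> nat" where
  "multilinear_rank d n A = vec_space.rank n (matricization d n 0 A)"

lemma set_n_lists_multi_indices:
  "set (List.n_lists m [0..<n]) = multi_indices m n"
  by (auto simp: set_n_lists multi_indices_def)

lemma insert_at_Suc:
  assumes "js \<in> multi_indices (d - 1) n" "Suc \<mu> < d" "i < n"
    and "antisymmetric_tensor d n A"
  shows "A (insert_at (Suc \<mu>) i js) = - A (insert_at \<mu> i js)"
proof -
  let ?is = "insert_at \<mu> i js"
  have len: "length js = d - 1" and sub: "set js \<subseteq> {..<n}"
    using assms(1) by (auto simp: multi_indices_def)
  have is_mem: "?is \<in> multi_indices d n"
    using len sub assms(2,3)
    by (auto simp: multi_indices_def insert_at_def dest: in_set_takeD in_set_dropD)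
  have mu: "\<mu> < length js" using len assms(2) by simp
  have "?is[\<mu> := ?is ! Suc \<mu>, Suc \<mu> := ?is ! \<mu>] = insert_at (Suc \<mu>) i js"
  proof (rule nth_equalityI)
    show "length (?is[\<mu> := ?is ! Suc \<mu>, Suc \<mu> := ?is ! \<mu>]) = length (insert_at (Suc \<mu>) i js)"
      using mu by (simp add: insert_at_def)
  next
    fix k assume "k < length (?is[\<mu> := ?is ! Suc \<mu>, Suc \<mu> := ?is ! \<mu>])"
    then have k: "k < Suc (length js)" by (simp add: insert_at_def)
    consider "k < \<mu>" | "k = \<mu>" | "k = Suc \<mu>" | m where "k = Suc (Suc (\<mu> + m))"
      by (metis add_Suc less_imp_Suc_add linorder_neqE_nat not_less_eq)
    then show "?is[\<mu> := ?is ! Suc \<mu>, Suc \<mu> := ?is ! \<mu>] ! k = insert_at (Suc \<mu>) i js ! k"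
      using mu k by cases (simp_all add: insert_at_def nth_append nth_list_update)
  qed
  moreover have "A (?is[\<mu> := ?is ! Suc \<mu>, Suc \<mu> := ?is ! \<mu>]) = - A ?is"
    using assms(2,4) is_mem unfolding antisymmetric_tensor_def by force
  ultimately show ?thesis by simp
qed

lemma matricization_Suc:
  assumes "antisymmetric_tensor d n A" "Suc \<mu> < d"
  shows "matricization d n (Suc \<mu>) A = - matricization d n \<mu> A"
proof (rule eq_matI)
  fix i k
  assume "i < dim_row (- matricization d n \<mu> A)" "k < dim_col (- matricization d n \<mu> A)"
  then have i: "i < n" and k: "k < n ^ (d - 1)" by (auto simp: matricization_def)
  then have "List.n_lists (d - 1) [0..<n] ! k \<in> multi_indices (d - 1) n"
    using set_n_lists_multi_indices[of "d - 1" n]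
    by (metis length_n_lists length_upt minus_nat.diff_0 nth_mem)
  then show "matricization d n (Suc \<mu>) A $$ (i, k) = (- matricization d n \<mu> A) $$ (i, k)"
    using i k insert_at_Suc[OF _ assms(2) i assms(1)] by (simp add: matricization_def)
qed (auto simp: matricization_def)

lemma (in vec_space) rank_uminus:
  assumes "M \<in> carrier_mat n nc"
  shows "rank (- M) = rank M"
proof -
  have le: "span (set (cols (- N))) \<subseteq> span (set (cols N))" if N: "N \<in> carrier_mat n nc" for N
  proof -
    have c: "set (cols N) \<subseteq> carrier_vec n" using cols_dim N by blast
    have "set (cols (- N)) \<subseteq> span (set (cols N))"
    proof
      fix v assume "v \<in> set (cols (- N))"
      then obtain j where j: "j < nc" "v = col (- N) j"
        using N by (auto simp: cols_def)
      have "v = - 1 \<cdot>\<^sub>v col N j" using j N by auto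
      moreover have "col N j \<in> span (set (cols N))"
        using j N by (intro span_mem[OF c]) (auto simp: cols_def)
      ultimately show "v \<in> span (set (cols N))" using smult_in_span[OF c] by simp
    qed
    then show ?thesis by (rule span_subsetI[OF c])
  qed
  have "- (- M) = M" using assms by (intro eq_matI) auto
  then have "span (set (cols (- M))) = span (set (cols M))"
    using le[OF assms] le[of "- M"] assms by simp
  then show ?thesis unfolding rank_def by simp
qed

lemma rank_matricization:
  assumes "antisymmetric_tensor d n A" "\<mu> < d"
  shows "vec_space.rank n (matricization d n \<mu> A) = multilinear_rank d n A"
  using assms(2)
proof (induction \<mu>)
  case 0
  then show ?case by (simp add: multilinear_rank_def)
next
  case (Suc \<mu>)
  have "matricization d n \<mu> A \<in> carrier_mat n (n ^ (d - 1))" by (simp add: matricization_def)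
  then show ?case
    using Suc matricization_Suc[OF assms(1)] vec_space.rank_uminus by (metis Suc_lessD)
qed

end

theory Submission
  imports Defs "HOL-Combinatorics.Permutations" "HOL-Number_Theory.Cong"
begin

text \<open>
  For \<open>n < d\<close> every multi-index has a repetition, so the tensor vanishes. For \<open>n = d + 1\<close> the
  tensor is, up to a volume form, the contraction of that form with a vector, and this vector
  annihilates the first mode, so the rank drops below \<open>n\<close>. Extremal tensors are supported on
  a family \<open>F\<close> of \<open>d\<close>-subsets of the index set such that each row \<open>i\<close> has a column whose only
  nonzero entry is in row \<open>i\<close>, that is, a \<open>(d - 1)\<close>-set that only \<open>i\<close> completes to a member
  of \<open>F\<close>. For \<open>n \<ge> d + 2\<close> the cyclic intervals of length \<open>d\<close> modulo \<open>n\<close> have this property.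
\<close>

section \<open>The rank of a real matrix\<close>

text \<open>A maximal independent set \<open>S\<close> of columns has as many elements as the rank.
  If there were \<open>n\<close> of them, they would span the space, and \<open>c\<close>,
  orthogonal to all columns, would be orthogonal to every unit vector.\<close>

lemma rank_le_dim_row:
  assumes M: "(M :: real mat) \<in> carrier_mat n nc"
  shows "vec_space.rank n M \<le> n"
    and "\<lbrakk>c \<in> carrier_vec n; c \<noteq> 0\<^sub>v n; \<And>w. w \<in> set (cols M) \<Longrightarrow> c \<bullet> w = 0\<rbrakk>
      \<Longrightarrow> vec_space.rank n M < n"
proof -
  interpret vec_space "TYPE(real)" n .
  obtain S where S: "maximal S (\<lambda>T. T \<subseteq> set (cols M) \<and> lin_indpt T)"
    using maximal_exists_superset[of "set (cols M)" "\<lambda>T. T \<subseteq> set (cols M) \<and> lin_indpt T" "{}"]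
      finite_lin_indpt2[of "{}"] by auto
  have SM: "S \<subseteq> set (cols M)" and li: "lin_indpt S" using S unfolding maximal_def by auto
  have cM: "set (cols M) \<subseteq> carrier_vec n" using cols_dim M by blast
  have Sc: "S \<subseteq> carrier_vec n" and fS: "finite S"
    using SM cM by (auto intro: finite_subset)
  have rk: "rank M = card S" by (rule rank_card_indpt[OF M S])
  show le: "rank M \<le> n" using li_le_dim(2)[of S] li Sc fin_dim dim_is_n rk by simp
  assume c: "c \<in> carrier_vec n" "c \<noteq> 0\<^sub>v n" and orth: "\<And>w. w \<in> set (cols M) \<Longrightarrow> c \<bullet> w = 0"
  show "rank M < n"
  proof (rule ccontr)
    assume "\<not> rank M < n"
    then have "basis S" using dim_li_is_basis[of S] li Sc fS fin_dim dim_is_n rk by simp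
    then have sp: "span S = carrier_vec n" unfolding basis_def by simp
    have "c $ i = 0" if i: "i < n" for i
    proof -
      have "unit_vec n i \<in> span S" using sp by simp
      then obtain a where a: "lincomb a S = unit_vec n i"
        using finite_in_span[OF fS, of "unit_vec n i"] Sc by blast
      have "c $ i = c \<bullet> unit_vec n i" using c i by simp
      also have "\<dots> = (\<Sum>k<n. c $ k * (\<Sum>w\<in>S. a w * w $ k))"
        unfolding a[symmetric] using lincomb_index[OF _ Sc] lincomb_dim[OF fS Sc]
        by (simp add: scalar_prod_def atLeast0LessThan)
      also have "\<dots> = (\<Sum>w\<in>S. a w * (\<Sum>k<n. c $ k * w $ k))"
        by (simp add: sum_distrib_left sum.swap[of _ S] ac_simps)
      also have "\<dots> = (\<Sum>w\<in>S. a w * (c \<bullet> w))"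
        using Sc by (intro sum.cong) (auto simp: scalar_prod_def atLeast0LessThan)
      also have "\<dots> = 0" using orth SM by (intro sum.neutral) auto
      finally show ?thesis .
    qed
    then have "c = 0\<^sub>v n" using c(1) by (intro eq_vecI) auto
    then show False using c(2) by simp
  qed
qed

text \<open>Each \<open>w i\<close> is a nonzero multiple of the \<open>i\<close>-th unit vector, so
  coordinate \<open>i\<close> of a vanishing combination isolates the coefficient of
  \<open>w i\<close>.\<close>

lemma rank_ge_diagonal:
  assumes M: "(M :: real mat) \<in> carrier_mat n nc" and r: "r \<le> n"
    and w: "\<And>i. i < r \<Longrightarrow> w i \<in> set (cols M)"
    and supp: "\<And>i x. i < r \<Longrightarrow> x < n \<Longrightarrow> w i $ x \<noteq> 0 \<longleftrightarrow> x = i"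
  shows "r \<le> vec_space.rank n M"
proof -
  interpret vec_space "TYPE(real)" n .
  let ?U = "w ` {..<r}"
  have inj: "inj_on w {..<r}"
    using supp r by (intro inj_onI) (metis lessThan_iff order.strict_trans2)
  have UM: "?U \<subseteq> set (cols M)" using w by auto
  then have Uc: "?U \<subseteq> carrier_vec n" using cols_dim M by blast
  have "lin_indpt ?U"
  proof
    assume "lin_dep ?U"
    then obtain a v where a: "lincomb a ?U = 0\<^sub>v n" and v: "v \<in> ?U" "a v \<noteq> 0"
      using finite_lin_dep[of ?U] Uc by auto
    then obtain i where i: "i < r" "v = w i" by auto
    have "0 = lincomb a ?U $ i" using a i r by simp
    also have "\<dots> = (\<Sum>k<r. a (w k) * w k $ i)"
      using lincomb_index[OF _ Uc, of i a] i r by (simp add: sum.reindex[OF inj])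
    also have "\<dots> = (\<Sum>k<r. if k = i then a (w k) * w k $ i else 0)"
      using supp[of _ i] i r by (intro sum.cong refl) auto
    also have "\<dots> = a (w i) * w i $ i" using i by simp
    finally show False using supp[of i i] i r v by simp
  qed
  then have "card ?U \<le> rank M" by (rule rank_ge_card_indpt[OF M UM])
  then show ?thesis by (simp add: card_image[OF inj])
qed

section \<open>Columns of the matricization\<close>

lemma matricization_carrier: "matricization d n \<mu> A \<in> carrier_mat n (n ^ (d - 1))"
  by (simp add: matricization_def)

text \<open>The rank depends only on the set of columns; in this form the enumeration by
  \<open>List.n_lists\<close> has disappeared.\<close>

lemma set_cols_matricization:
  "set (cols (matricization d n 0 A)) =
     (\<lambda>js. vec n (\<lambda>i. A (i # js))) ` multi_indices (d - 1) n"
proof -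
  let ?L = "List.n_lists (d - 1) [0..<n]"
  have len: "length ?L = n ^ (d - 1)" by (simp add: length_n_lists)
  have "set (cols (matricization d n 0 A)) = col (matricization d n 0 A) ` {..<n ^ (d - 1)}"
    using matricization_carrier[of d n 0 A] by (auto simp: cols_def)
  also have "\<dots> = (\<lambda>k. vec n (\<lambda>i. A (i # ?L ! k))) ` {..<length ?L}"
    unfolding len
    by (intro image_cong) (auto simp: matricization_def insert_at_def intro!: eq_vecI)
  also have "\<dots> = (\<lambda>js. vec n (\<lambda>i. A (i # js))) ` (nth ?L ` {..<length ?L})"
    by (simp only: image_image)
  also have "nth ?L ` {..<length ?L} = set ?L"
    by (auto simp: set_conv_nth)
  also have "\<dots> = multi_indices (d - 1) n" by (rule set_n_lists_multi_indices)
  finally show ?thesis .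
qed

lemma multilinear_rank_ge:
  assumes "r \<le> n"
    and "\<And>i. i < r \<Longrightarrow> \<exists>js \<in> multi_indices (d - 1) n. \<forall>x<n. A (x # js) \<noteq> 0 \<longleftrightarrow> x = i"
  shows "r \<le> multilinear_rank d n A"
proof -
  obtain js where js: "\<And>i. i < r \<Longrightarrow> js i \<in> multi_indices (d - 1) n"
    "\<And>i x. i < r \<Longrightarrow> x < n \<Longrightarrow> A (x # js i) \<noteq> 0 \<longleftrightarrow> x = i"
    using assms(2) by metis
  show ?thesis unfolding multilinear_rank_def
    using js assms(1)
    by (intro rank_ge_diagonal[OF matricization_carrier, of r n
          "\<lambda>i. vec n (\<lambda>x. A (x # js i))"]) (auto simp: set_cols_matricization)
qed

section \<open>Antisymmetric functions of lists\<close>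

text \<open>Exchanging two equal entries fixes \<open>js\<close>, so a repetition forces
  \<open>A js = - A js\<close>.\<close>

lemma antisymmetric_tensor_nonzero_distinct:
  assumes A: "antisymmetric_tensor d n A" and js: "js \<in> multi_indices d n" and "A js \<noteq> 0"
  shows "distinct js"
proof (rule ccontr)
  assume "\<not> distinct js"
  then obtain \<mu> \<nu> where "\<mu> < length js" "\<nu> < length js" "\<mu> \<noteq> \<nu>" and eq: "js ! \<mu> = js ! \<nu>"
    by (auto simp: distinct_conv_nth)
  then have "A (js[\<mu> := js ! \<nu>, \<nu> := js ! \<mu>]) = - A js"
    using A js unfolding antisymmetric_tensor_def multi_indices_def by blast
  moreover have "js[\<mu> := js ! \<nu>, \<nu> := js ! \<mu>] = js" using eq by (metis list_update_id)
  ultimately show False using assms(3) by simp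
qed

text \<open>Transpositions generate all permutations. Invariance is assumed only on rearrangements
  of \<open>ys\<close>, since a tensor is antisymmetric only on its multi-indices.\<close>

lemma swap_invariant_mset_eq:
  assumes "mset xs = mset ys"
    and swap: "\<And>zs \<mu> \<nu>. \<lbrakk>mset zs = mset ys; \<mu> < length zs; \<nu> < length zs; \<mu> \<noteq> \<nu>\<rbrakk>
      \<Longrightarrow> F (zs[\<mu> := zs ! \<nu>, \<nu> := zs ! \<mu>]) = F zs"
  shows "F xs = F ys"
proof -
  obtain p where p: "p permutes {..<length ys}" and xs: "permute_list p ys = xs"
    using mset_eq_permutation[OF assms(1)] .
  \<comment> \<open>Quantified over \<open>zs\<close> because the induction hypothesis is applied to
    a list with two entries already exchanged.\<close>
  have "\<forall>zs. mset zs = mset ys \<longrightarrow> F (permute_list p zs) = F zs"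
    using p finite_lessThan
  proof (induction rule: permutes_induct)
    case id
    then show ?case by simp
  next
    case (swap a b p)
    show ?case
    proof (intro allI impI)
      fix zs assume zs: "mset zs = mset ys"
      then have len: "length zs = length ys" by (rule mset_eq_length)
      let ?zs = "zs[a := zs ! b, b := zs ! a]"
      have ab: "a < length zs" "b < length zs" using swap len by auto
      have "permute_list (Transposition.transpose a b) zs = ?zs"
        using ab by (intro nth_equalityI)
          (auto simp: permute_list_def Transposition.transpose_def nth_list_update)
      then have "permute_list (Transposition.transpose a b \<circ> p) zs = permute_list p ?zs"
        using permute_list_compose[of p zs "Transposition.transpose a b"] swap.hyps len by simp
      moreover have "mset ?zs = mset ys" using ab zs by (simp add: mset_swap)
      ultimately show "F (permute_list (Transposition.transpose a b \<circ> p) zs) = F zs"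
        using swap.IH swap.hyps(3) assms(2)[OF zs ab] by simp
    qed
  qed
  then show ?thesis using xs by blast
qed

text \<open>Serves as an antisymmetric sign that is nonzero on all lists without repetition.\<close>

definition vandermonde :: "nat list \<Rightarrow> real" where
  "vandermonde js =
     det (mat (length js) (length js) (\<lambda>(i, j). real (js ! j) ^ i))"

lemma vandermonde_swap:
  assumes "\<mu> < length js" "\<nu> < length js" "\<mu> \<noteq> \<nu>"
  shows "vandermonde (js[\<mu> := js ! \<nu>, \<nu> := js ! \<mu>]) = - vandermonde js"
proof -
  let ?V = "\<lambda>js. mat (length js) (length js) (\<lambda>(i, j). real (js ! j) ^ i)"
  have "?V (js[\<mu> := js ! \<nu>, \<nu> := js ! \<mu>]) = swapcols \<mu> \<nu> (?V js)"
    using assms by (intro eq_matI) (auto simp: nth_list_update)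
  then show ?thesis
    using det_swapcols[OF assms, of "?V js"] by (simp add: vandermonde_def)
qed

text \<open>A kernel vector of the transposed matrix would hold the coefficients of a nonzero
  polynomial of degree below \<open>m\<close> with \<open>m\<close> distinct roots.\<close>

lemma vandermonde_nonzero:
  assumes "distinct js"
  shows "vandermonde js \<noteq> 0"
proof
  assume 0: "vandermonde js = 0"
  define m where "m = length js"
  let ?V = "mat m m (\<lambda>(i, j). real (js ! j) ^ i)"
  have V: "?V \<in> carrier_mat m m" by simp
  have "det (transpose_mat ?V) = 0"
    using 0 det_transpose[OF V] by (simp add: vandermonde_def m_def)
  then obtain v where v: "v \<in> carrier_vec m" "v \<noteq> 0\<^sub>v m" "transpose_mat ?V *\<^sub>v v = 0\<^sub>v m"
    using det_0_iff_vec_prod_zero_field[of "transpose_mat ?V" m] by auto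
  define p where "p = (\<Sum>i<m. monom (v $ i) i)"
  have coeff: "coeff p i = v $ i" if "i < m" for i
    using that by (simp add: p_def coeff_sum)
  have "p \<noteq> 0" using coeff v(1,2) by (metis coeff_0 eq_vecI carrier_vecD index_zero_vec)
  \<comment> \<open>Ensures that the truncated \<open>m - 1\<close> is really smaller than the
    number \<open>m\<close> of roots.\<close>
  have "m > 0" using v by (cases m) auto
  have "degree p \<le> m - 1"
    unfolding p_def by (intro degree_sum_le) (auto intro: order.trans[OF degree_monom_le])
  have root: "poly p (real (js ! j)) = 0" if j: "j < m" for j
  proof -
    have "poly p (real (js ! j)) = (transpose_mat ?V *\<^sub>v v) $ j"
      using j v(1)
      by (simp add: p_def poly_sum poly_monom scalar_prod_def atLeast0LessThan mult.commute)
    then show ?thesis using v(3) j by simp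
  qed
  have "real ` set js \<subseteq> {x. poly p x = 0}"
    using root by (auto simp: in_set_conv_nth m_def)
  then have "card (real ` set js) \<le> card {x. poly p x = 0}"
    by (rule card_mono[OF poly_roots_finite[OF \<open>p \<noteq> 0\<close>]])
  moreover have "card (real ` set js) = m"
    using assms by (simp add: card_image inj_on_def distinct_card m_def)
  moreover have "card {x. poly p x = 0} \<le> degree p" by (rule card_poly_roots_bound[OF \<open>p \<noteq> 0\<close>])
  ultimately show False using \<open>degree p \<le> m - 1\<close> \<open>m > 0\<close> by linarith
qed

section \<open>Upper bounds\<close>

lemma distinct_multi_indices_length_le:
  assumes "js \<in> multi_indices d n" "distinct js"
  shows "d \<le> n"
  using assms distinct_card[of js] card_mono[of "{..<n}" "set js"] by (auto simp: multi_indices_def)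

lemma multilinear_rank_eq_0:
  assumes "0 < d" and zero: "\<And>js. js \<in> multi_indices d n \<Longrightarrow> A js = 0"
  shows "multilinear_rank d n A = 0"
proof -
  have "matricization d n 0 A = 0\<^sub>m n (n ^ (d - 1))"
  proof (rule eq_matI)
    fix i k assume "i < dim_row (0\<^sub>m n (n ^ (d - 1)))" "k < dim_col (0\<^sub>m n (n ^ (d - 1)))"
    then have i: "i < n" and k: "k < n ^ (d - 1)" by auto
    then have "List.n_lists (d - 1) [0..<n] ! k \<in> multi_indices (d - 1) n"
      using set_n_lists_multi_indices[of "d - 1" n]
      by (metis length_n_lists length_upt minus_nat.diff_0 nth_mem)
    then have "i # List.n_lists (d - 1) [0..<n] ! k \<in> multi_indices d n"
      using i \<open>0 < d\<close> by (auto simp: multi_indices_def)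
    then show "matricization d n 0 A $$ (i, k) = 0\<^sub>m n (n ^ (d - 1)) $$ (i, k)"
      using zero i k by (simp add: matricization_def insert_at_def)
  qed (auto simp: matricization_def)
  then show ?thesis by (simp add: multilinear_rank_def vec_space.rank_0I)
qed

lemma multilinear_rank_le: "multilinear_rank d n A \<le> n"
  unfolding multilinear_rank_def by (rule rank_le_dim_row(1)[OF matricization_carrier])

text \<open>
  For \<open>n = d + 1\<close> the product \<open>vandermonde (x # js) * A js\<close> does not depend on the order of
  \<open>js\<close>, so it is the \<open>x\<close>-th coordinate of a vector \<open>c\<close>. This is the Hodge dual of \<open>A\<close>
  up to signs and scaling by \<open>vandermonde\<close>; contracting \<open>A\<close> with it gives zero.
\<close>

lemma multilinear_rank_codim_1:
  assumes d: "0 < d" and A: "antisymmetric_tensor d (d + 1) A"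
  shows "multilinear_rank d (d + 1) A \<le> d"
proof (cases "\<forall>js \<in> multi_indices d (d + 1). A js = 0")
  \<comment> \<open>The zero tensor is treated apart because its vector \<open>c\<close> would
    vanish.\<close>
  case True
  then show ?thesis using multilinear_rank_eq_0[OF d] by simp
next
  case False
  let ?n = "d + 1"
  \<comment> \<open>The \<open>d\<close> indices other than \<open>x\<close> in increasing order: a
    canonical representative of all lists that complete \<open>x\<close>.\<close>
  define ys where "ys x = filter (\<lambda>y. y \<noteq> x) [0..<?n]" for x
  define c where "c x = vandermonde (x # ys x) * A (ys x)" for x
  have c_eq: "c x = vandermonde (x # js) * A js"
    if x: "x < ?n" and js: "js \<in> multi_indices d ?n" "distinct (x # js)" for x js
  proof -
    have "set js \<subseteq> {..<?n} - {x}" using js by (auto simp: multi_indices_def)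
    moreover have "card (set js) = card ({..<?n} - {x})"
      using js x by (simp add: distinct_card multi_indices_def)
    ultimately have "set js = {..<?n} - {x}" by (intro card_subset_eq) auto
    moreover have "set (ys x) = {..<?n} - {x}" "distinct (ys x)"
      by (auto simp: ys_def simp del: upt_Suc)
    ultimately have "mset (ys x) = mset js"
      using js(2) set_eq_iff_mset_eq_distinct[of "ys x" js] by simp
    then have "vandermonde (x # ys x) * A (ys x) = vandermonde (x # js) * A js"
    proof (rule swap_invariant_mset_eq)
      fix zs \<mu> \<nu>
      assume "mset zs = mset js" and mn: "\<mu> < length zs" "\<nu> < length zs" "\<mu> \<noteq> \<nu>"
      then have zs: "zs \<in> multi_indices d ?n"
        using js(1) by (auto simp: multi_indices_def dest: mset_eq_length mset_eq_setD)
      have "vandermonde (x # zs[\<mu> := zs ! \<nu>, \<nu> := zs ! \<mu>]) = - vandermonde (x # zs)"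
        using vandermonde_swap[of "Suc \<mu>" "x # zs" "Suc \<nu>"] mn by simp
      moreover have "A (zs[\<mu> := zs ! \<nu>, \<nu> := zs ! \<mu>]) = - A zs"
        using A zs mn unfolding antisymmetric_tensor_def by (auto simp: multi_indices_def)
      ultimately show "vandermonde (x # zs[\<mu> := zs ! \<nu>, \<nu> := zs ! \<mu>]) *
          A (zs[\<mu> := zs ! \<nu>, \<nu> := zs ! \<mu>]) = vandermonde (x # zs) * A zs"
        by simp
    qed
    then show ?thesis by (simp add: c_def)
  qed
  have orth: "(\<Sum>x<?n. c x * A (x # js)) = 0" if js: "js \<in> multi_indices (d - 1) ?n" for js
  proof -
    have mem: "x # js \<in> multi_indices d ?n" if "x < ?n" for x
      using js d that by (auto simp: multi_indices_def)
    have nz: "distinct (x # js)" if "x < ?n" "A (x # js) \<noteq> 0" for x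
      using antisymmetric_tensor_nonzero_distinct[OF A mem] that by blast
    show ?thesis
    proof (cases "distinct js")
      case False
      then show ?thesis using nz by (intro sum.neutral) auto
    next
      case True
      have sub: "set js \<subseteq> {..<?n}" and "card (set js) = d - 1"
        using js True by (auto simp: multi_indices_def distinct_card)
      \<comment> \<open>Only the two indices missing from \<open>js\<close> can contribute. Both
        terms contain \<open>A (x # js) * A (y # js)\<close>, with Vandermonde factors of opposite
        sign.\<close>
      then have "card ({..<?n} - set js) = 2" using d by (simp add: card_Diff_subset)
      then obtain x y where xy: "{..<?n} - set js = {x, y}" "x \<noteq> y"
        by (auto simp: card_2_iff)
      then have x: "x < ?n" "x \<notin> set js" and y: "y < ?n" "y \<notin> set js" by auto
      have cx: "c x = vandermonde (x # y # js) * A (y # js)"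
        using c_eq[OF x(1) mem[OF y(1)]] x y xy(2) True by auto
      have cy: "c y = vandermonde (y # x # js) * A (x # js)"
        using c_eq[OF y(1) mem[OF x(1)]] x y xy(2) True by auto
      have sw: "vandermonde (y # x # js) = - vandermonde (x # y # js)"
        using vandermonde_swap[of 0 "x # y # js" 1] by simp
      have "(\<Sum>z<?n. c z * A (z # js)) = (\<Sum>z\<in>{x, y}. c z * A (z # js))"
        unfolding xy(1)[symmetric] using nz by (intro sum.mono_neutral_right) auto
      also have "\<dots> = 0" using xy(2) by (simp add: cx cy sw)
      finally show ?thesis .
    qed
  qed
  \<comment> \<open>A nonzero entry of \<open>A\<close> omits exactly one index \<open>x\<close>,
    and there \<open>c x\<close> is that entry times a nonzero Vandermonde determinant.\<close>
  obtain js where js: "js \<in> multi_indices d ?n" "A js \<noteq> 0" using False by blast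
  have dist: "distinct js" by (rule antisymmetric_tensor_nonzero_distinct[OF A js])
  have "card (set js) < card {..<?n}" using js dist by (simp add: multi_indices_def distinct_card)
  then have "\<not> {..<?n} \<subseteq> set js" by (metis List.finite_set card_mono not_less)
  then obtain x where x: "x < ?n" "x \<notin> set js" by auto
  then have "c x \<noteq> 0" using c_eq[OF x(1) js(1)] js(2) dist vandermonde_nonzero[of "x # js"] by simp
  then have "vec ?n c \<noteq> 0\<^sub>v ?n" using x(1) by (metis index_vec index_zero_vec(1))
  moreover have "vec ?n c \<bullet> w = 0" if "w \<in> set (cols (matricization d ?n 0 A))" for w
    using that orth
    by (auto simp: set_cols_matricization scalar_prod_def atLeast0LessThan)
  ultimately have "multilinear_rank d ?n A < ?n"
    unfolding multilinear_rank_def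
    by (intro rank_le_dim_row(2)[OF matricization_carrier, of "vec ?n c"]) auto
  then show ?thesis by simp
qed

section \<open>Tensors of maximal rank\<close>

text \<open>The support condition reads only the set of indices, so it survives every exchange and
  all signs come from \<open>vandermonde\<close>.\<close>

definition family_tensor :: "nat set set \<Rightarrow> tensor" where
  "family_tensor F js = (if set js \<in> F then vandermonde js else 0)"

lemma antisymmetric_family_tensor: "antisymmetric_tensor d n (family_tensor F)"
  unfolding antisymmetric_tensor_def family_tensor_def
  by (auto simp: multi_indices_def vandermonde_swap)

text \<open>The column indexed by an enumeration of \<open>S - {i}\<close> has its only nonzero
  entry in row \<open>i\<close>; the cardinality condition gives this index the length
  \<open>d - 1\<close>.\<close>

lemma multilinear_rank_family_tensor_ge:
  assumes d: "0 < d" and "r \<le> n" and card: "\<And>S. S \<in> F \<Longrightarrow> card S = d"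
    and F: "\<And>i. i < r \<Longrightarrow> \<exists>S \<in> F. S \<subseteq> {..<n} \<and> i \<in> S \<and>
      (\<forall>x<n. insert x (S - {i}) \<in> F \<longrightarrow> x = i)"
  shows "r \<le> multilinear_rank d n (family_tensor F)"
proof (rule multilinear_rank_ge[OF \<open>r \<le> n\<close>])
  fix i assume "i < r"
  then obtain S where S: "S \<in> F" "S \<subseteq> {..<n}" "i \<in> S"
    and uniq: "\<And>x. x < n \<Longrightarrow> insert x (S - {i}) \<in> F \<Longrightarrow> x = i" using F by blast
  have fin: "finite S" using S(2) finite_subset by blast
  define js where "js = sorted_list_of_set (S - {i})"
  have set: "set js = S - {i}" and dist: "distinct js" and len: "length js = d - 1"
    using fin S card by (auto simp: js_def)
  have "js \<in> multi_indices (d - 1) n" using set len S by (auto simp: multi_indices_def)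
  moreover have "family_tensor F (x # js) \<noteq> 0 \<longleftrightarrow> x = i" if "x < n" for x
  proof
    assume "family_tensor F (x # js) \<noteq> 0"
    then show "x = i" using uniq[OF that] set by (auto simp: family_tensor_def split: if_splits)
  next
    assume "x = i"
    then show "family_tensor F (x # js) \<noteq> 0"
      using S set dist vandermonde_nonzero[of "i # js"]
      by (simp add: family_tensor_def insert_absorb)
  qed
  ultimately show "\<exists>js \<in> multi_indices (d - 1) n. \<forall>x<n. family_tensor F (x # js) \<noteq> 0 \<longleftrightarrow> x = i"
    by blast
qed

section \<open>Cyclic intervals as an extremal family\<close>

definition cyclic_window :: "nat \<Rightarrow> nat \<Rightarrow> nat \<Rightarrow> nat set" where
  "cyclic_window d n a = (\<lambda>k. (a + k) mod n) ` {..<d}"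

lemma card_cyclic_window:
  assumes "d \<le> n"
  shows "card (cyclic_window d n a) = d"
proof -
  have "inj_on (\<lambda>k. (a + k) mod n) {..<d}"
  proof (rule inj_onI)
    fix k l assume "k \<in> {..<d}" "l \<in> {..<d}" "(a + k) mod n = (a + l) mod n"
    then have "[k = l] (mod n)" by (simp add: cong_def[symmetric] cong_add_lcancel_nat)
    then show "k = l" using \<open>k \<in> {..<d}\<close> \<open>l \<in> {..<d}\<close> assms by (simp add: cong_def)
  qed
  then show ?thesis by (simp add: cyclic_window_def card_image)
qed

text \<open>A point at offset \<open>k\<close> whose successor leaves the window must have
  \<open>k = d - 1\<close>.\<close>

lemma cyclic_window_right_end:
  assumes "x \<in> cyclic_window d n a" "Suc x mod n \<notin> cyclic_window d n a"
  shows "Suc x mod n = (a + d) mod n"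
proof -
  obtain k where k: "k < d" "x = (a + k) mod n" using assms(1) by (auto simp: cyclic_window_def)
  then have *: "Suc x mod n = (a + Suc k) mod n" by (simp add: mod_Suc_eq)
  then have "\<not> Suc k < d"
    using assms(2) unfolding cyclic_window_def by (metis imageI lessThan_iff)
  then show ?thesis using k(1) * by (metis Suc_lessI)
qed

text \<open>If the successor had a positive offset \<open>k\<close>, cancelling 1 modulo
  \<open>n\<close> would put \<open>x\<close> at offset \<open>k - 1\<close>, inside the
  window.\<close>

lemma cyclic_window_left_end:
  assumes "Suc x mod n \<in> cyclic_window d n a" "x \<notin> cyclic_window d n a" "x < n"
  shows "Suc x mod n = a mod n"
proof -
  obtain k where k: "k < d" "Suc x mod n = (a + k) mod n"
    using assms(1) by (auto simp: cyclic_window_def)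
  show ?thesis
  proof (cases k)
    case 0
    then show ?thesis using k by simp
  next
    case (Suc l)
    then have "[x + 1 = (a + l) + 1] (mod n)" using k by (simp add: cong_def)
    then have "x mod n = (a + l) mod n" by (simp only: cong_add_rcancel_nat) (simp add: cong_def)
    then have "x \<in> cyclic_window d n a" using k Suc assms(3) by (auto simp: cyclic_window_def)
    then show ?thesis using assms(2) by simp
  qed
qed

text \<open>
  The window starting at \<open>i - 1\<close> has \<open>i\<close> as an interior point because \<open>d \<ge> 3\<close>. A window that
  contains \<open>i - 1\<close> and \<open>i + 1\<close> but not \<open>i\<close> ends at \<open>i - 1\<close> and starts at \<open>i + 1\<close>, so it has
  length congruent to \<open>-1\<close> modulo \<open>n\<close>, contrary to \<open>d + 2 \<le> n\<close>.
\<close>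

lemma cyclic_window_unique_completion:
  assumes d: "3 \<le> d" "d + 2 \<le> n" and i: "i < n"
  obtains p where "i \<in> cyclic_window d n p"
    "\<And>x a. insert x (cyclic_window d n p - {i}) = cyclic_window d n a \<Longrightarrow> x = i"
proof
  \<comment> \<open>This is \<open>i - 1\<close> modulo \<open>n\<close>, also correct for
    \<open>i = 0\<close>.\<close>
  define p where "p = (i + (n - 1)) mod n"
  have pi: "Suc p mod n = i" using i d by (simp add: p_def mod_Suc_eq)
  have p: "p < n" using d by (simp add: p_def)
  have mem: "(p + k) mod n \<in> cyclic_window d n p" if "k < d" for k
    using that by (auto simp: cyclic_window_def)
  show "i \<in> cyclic_window d n p" using mem[of 1] pi d by simp
  fix x a
  assume eq: "insert x (cyclic_window d n p - {i}) = cyclic_window d n a"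
  show "x = i"
  proof (rule ccontr)
    assume "x \<noteq> i"
    then have iW: "i \<notin> cyclic_window d n a" using eq by auto
    have "p \<noteq> i" using pi p d by (auto simp: mod_Suc split: if_splits)
    then have "p \<in> cyclic_window d n a" using mem[of 0] p d eq by auto
    then have r: "i = (a + d) mod n" using cyclic_window_right_end[of p d n a] pi iW by simp
    \<comment> \<open>The other neighbour of \<open>i\<close> has offset 2, which is below
      \<open>d\<close>, so deleting \<open>i\<close> leaves it in the set.\<close>
    have "Suc i mod n = (p + 2) mod n" using pi by (metis add_2_eq_Suc' mod_Suc_eq)
    then have "Suc i mod n \<in> cyclic_window d n p" using mem[of 2] d by simp
    moreover have "Suc i mod n \<noteq> i" using i d by (auto simp: mod_Suc split: if_splits)
    ultimately have "Suc i mod n \<in> cyclic_window d n a" using eq by auto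
    then have "Suc i mod n = a mod n" using cyclic_window_left_end iW i by blast
    \<comment> \<open>The gap \<open>i\<close> lies just past the end of the window and just before
      its start, so \<open>n\<close> would divide \<open>d + 1\<close>, although
      \<open>0 < d + 1 < n\<close>.\<close>
    then have "(a + (d + 1)) mod n = (a + 0) mod n" using r by (simp add: mod_Suc_eq)
    then have "[d + 1 = 0] (mod n)" by (simp only: cong_def[symmetric] cong_add_lcancel_nat)
    then show False using d by (simp add: cong_def)
  qed
qed

theorem theorem2p2:
  fixes d n :: nat
  assumes "d \<ge> 3" and "n \<ge> 1"
  shows "(\<forall>A. antisymmetric_tensor d n A \<longrightarrow>
            (n < d \<longrightarrow> multilinear_rank d n A = 0) \<and>
            (n = d \<or> n = d + 1 \<longrightarrow> multilinear_rank d n A \<le> d) \<and>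
            (n \<ge> d + 2 \<longrightarrow> multilinear_rank d n A \<le> n)) \<and>
         (\<exists>A. antisymmetric_tensor d n A \<and>
            (n < d \<longrightarrow> multilinear_rank d n A = 0) \<and>
            (n = d \<or> n = d + 1 \<longrightarrow> multilinear_rank d n A = d) \<and>
            (n \<ge> d + 2 \<longrightarrow> multilinear_rank d n A = n))"
proof -
  have d: "0 < d" using assms by simp
  have small: "multilinear_rank d n A = 0" if "antisymmetric_tensor d n A" "n < d" for A
    using that antisymmetric_tensor_nonzero_distinct distinct_multi_indices_length_le
    by (intro multilinear_rank_eq_0[OF d]) (metis not_less)
  have middle: "multilinear_rank d n A \<le> d"
    if "antisymmetric_tensor d n A" "n = d \<or> n = d + 1" for A
    using that multilinear_rank_codim_1[OF d] multilinear_rank_le[of d n A] by auto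
  have "\<exists>A. antisymmetric_tensor d n A \<and>
            (n < d \<longrightarrow> multilinear_rank d n A = 0) \<and>
            (n = d \<or> n = d + 1 \<longrightarrow> multilinear_rank d n A = d) \<and>
            (n \<ge> d + 2 \<longrightarrow> multilinear_rank d n A = n)"
  proof (cases "n \<ge> d + 2")
    case True
    let ?F = "range (cyclic_window d n)"
    have "n \<le> multilinear_rank d n (family_tensor ?F)"
    proof (rule multilinear_rank_family_tensor_ge[OF d order.refl])
      fix S assume "S \<in> ?F"
      then show "card S = d" using card_cyclic_window True by auto
    next
      fix i assume "i < n"
      then obtain p where p: "i \<in> cyclic_window d n p"
        "\<And>x a. insert x (cyclic_window d n p - {i}) = cyclic_window d n a \<Longrightarrow> x = i"
        using cyclic_window_unique_completion[OF assms(1) True] by blast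
      have "cyclic_window d n p \<subseteq> {..<n}" using assms(2) by (auto simp: cyclic_window_def)
      then show "\<exists>S \<in> ?F. S \<subseteq> {..<n} \<and> i \<in> S \<and>
          (\<forall>x<n. insert x (S - {i}) \<in> ?F \<longrightarrow> x = i)"
        using p by blast
    qed
    then show ?thesis
      using True antisymmetric_family_tensor[of d n ?F] multilinear_rank_le[of d n "family_tensor ?F"]
      by (intro exI[of _ "family_tensor ?F"]) auto
  next
    case False
    \<comment> \<open>One set suffices for \<open>d \<le> n\<close>: each \<open>i < d\<close> is
      the only index that restores \<open>{..<d}\<close> after its removal. For \<open>n < d\<close>
      every antisymmetric tensor has rank 0.\<close>
    let ?A = "family_tensor {{..<d}}"
    have anti: "antisymmetric_tensor d n ?A" by (rule antisymmetric_family_tensor)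
    have "d \<le> multilinear_rank d n ?A" if "d \<le> n"
    proof (rule multilinear_rank_family_tensor_ge[OF d that])
      fix i assume "i < d"
      then show "\<exists>S \<in> {{..<d}}. S \<subseteq> {..<n} \<and> i \<in> S \<and>
          (\<forall>x<n. insert x (S - {i}) \<in> {{..<d}} \<longrightarrow> x = i)"
        using that by (intro bexI[of _ "{..<d}"]) (auto dest!: equalityD2)
    qed simp
    then show ?thesis using False anti small[OF anti] middle[OF anti]
      by (intro exI[of _ ?A]) auto
  qed
  then show ?thesis using small middle multilinear_rank_le by blast
qed

end
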